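(* Let $(X,X_+)$ be a finite-dimensional pre-Riesz space and assume that $X_+$ is closed. Suppose that all vectors $x,y \in X_+$ that satisfy $[-x,x] \cap [-y,y] = \{0\}$ are disjoint. Then $X$ is a vector lattice.
   Context: An ordered vector space $(X,X_+)$ is a real vector space $X$ with a non-empty set $X_+ \subseteq X$ such that $X_+ \cap (-X_+) = \{0\}$ and $\alpha X_+ + \beta X_+ \subseteq X_+$ for all $\alpha,\beta \in [0,\infty)$; one writes $x \le y$ if $y - x \in X_+$, and $[x,z] := \{y \in X : x \le y \le z\}$. It is a vector lattice if any two elements have a supremum and an infimum. It is a pre-Riesz space if for every non-empty finite set $A \subseteq X$ and every $x \in X$: if every upper bound of $x + A$ is an upper bound of $A$, then $x \in X_+$. Closedness in a finite-dimensional space is with respect to the usual (Euclidean) topology. Two elements $x,y \in X$ are disjoint, $x \perp y$, if the sets $\{x+y,-x-y\}$ and $\{x-y,y-x\}$ have the same set of upper bounds in $X$ (for $x,y \in X_+$ this is equivalent to $\inf\{x,y\}$ existing in $X$ and being $0$). *)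

theory Defs
  imports "HOL-Analysis.Analysis"
begin

(* An ordered vector space (X, X_+) is a type of class ordered_real_vector: the cone
   axioms for X_+ = {x. 0 <= x} are equivalent to the axioms of that class for
   x <= y iff y - x in X_+. Order intervals [x, z] are the library sets {x..z}. *)

definition upper_bounds :: "'a::ord set \<Rightarrow> 'a set" where
  "upper_bounds A = {u. \<forall>a\<in>A. a \<le> u}"

definition is_supremum :: "'a::ord set \<Rightarrow> 'a \<Rightarrow> bool" where
  "is_supremum A s \<longleftrightarrow> s \<in> upper_bounds A \<and> (\<forall>u\<in>upper_bounds A. s \<le> u)"

definition is_infimum :: "'a::ord set \<Rightarrow> 'a \<Rightarrow> bool" where
  "is_infimum A i \<longleftrightarrow> (\<forall>a\<in>A. i \<le> a) \<and> (\<forall>l. (\<forall>a\<in>A. l \<le> a) \<longrightarrow> l \<le> i)"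

definition is_pre_riesz :: "'a::ordered_real_vector itself \<Rightarrow> bool" where
  "is_pre_riesz _ \<longleftrightarrow>
     (\<forall>(A :: 'a set) x. finite A \<and> A \<noteq> {} \<and>
        upper_bounds ((\<lambda>a. x + a) ` A) \<subseteq> upper_bounds A \<longrightarrow> 0 \<le> x)"

definition disjoint_elements :: "'a::ordered_real_vector \<Rightarrow> 'a \<Rightarrow> bool" where
  "disjoint_elements x y \<longleftrightarrow> upper_bounds {x + y, - x - y} = upper_bounds {x - y, y - x}"

definition is_vector_lattice :: "'a::ordered_real_vector itself \<Rightarrow> bool" where
  "is_vector_lattice _ \<longleftrightarrow>
     (\<forall>x y :: 'a. (\<exists>s. is_supremum {x, y} s) \<and> (\<exists>i. is_infimum {x, y} i))"

(* The usual topology of a finite-dimensional X is that of an arbitrary norm on X: all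
   norms induce it. No compatibility between norm and order is assumed. *)
definition finite_dimensional :: "'a::real_vector itself \<Rightarrow> bool" where
  "finite_dimensional _ \<longleftrightarrow> (\<exists>B :: 'a set. finite B \<and> span B = UNIV)"

end

theory Submission
  imports Defs
begin

text \<open>
  Two non-proportional extremal vectors of the cone satisfy the interval condition, hence are
  disjoint, which means that their supremum is their sum. Therefore a common upper bound of finitely
  many pairwise non-proportional extremal vectors dominates their sum, and so these vectors are
  linearly independent. Every nonzero positive vector dominates an extremal one: if \<open>y\<close> is
  not extremal, subtracting a maximal multiple of some \<open>z \<in> [0, y]\<close> shrinks the face generated
  by \<open>y\<close>. Subtracting maximal multiples of all normalised extremal vectors from a positive vector
  thus leaves \<open>0\<close>, so these vectors form a basis whose nonnegative combinations are exactly the cone.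
\<close>

section \<open>Extremal vectors and preliminaries on the order\<close>

definition extremal :: "'a::ordered_real_vector \<Rightarrow> bool" where
  "extremal e \<longleftrightarrow> 0 < e \<and> (\<forall>z. 0 \<le> z \<and> z \<le> e \<longrightarrow> (\<exists>t. z = t *\<^sub>R e))"

text \<open>Norm one selects exactly one representative on every extremal ray, so distinct members
  are non-proportional. Any norm serves this purpose.\<close>

definition unit_extremals :: "'a::{real_normed_vector, ordered_real_vector} set" where
  "unit_extremals = {e. extremal e \<and> norm e = 1}"

text \<open>If \<open>a\<close> and \<open>b\<close> had no common upper bound, no translate of
  \<open>{a, b}\<close> would have one either. The pre-Riesz condition would then hold vacuously and
  make every vector positive, in particular \<open>b - a\<close>, so that \<open>b\<close> itself
  would be a common bound.\<close>

lemma pre_riesz_directed: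
  fixes a b :: "'a::ordered_real_vector"
  assumes "is_pre_riesz TYPE('a)"
  obtains u where "a \<le> u" "b \<le> u"
proof (rule ccontr)
  assume "\<not> thesis"
  then have none: "\<not> (a \<le> u \<and> b \<le> u)" for u
    using that by blast
  have "0 \<le> x" for x :: 'a
  proof -
    have "upper_bounds ((\<lambda>c. x + c) ` {a, b}) \<subseteq> upper_bounds {a, b}"
    proof
      fix u assume "u \<in> upper_bounds ((\<lambda>c. x + c) ` {a, b})"
      then have "a \<le> u - x \<and> b \<le> u - x"
        by (simp add: upper_bounds_def algebra_simps)
      with none show "u \<in> upper_bounds {a, b}" by blast
    qed
    with assms show ?thesis
      unfolding is_pre_riesz_def by (metis finite.emptyI finite_insert insert_not_empty)
  qed
  from this[of "b - a"] have "a \<le> b" by simp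
  with none[of b] show False by simp
qed

lemma disjoint_upper_bound:
  fixes x y v :: "'a::ordered_real_vector"
  assumes "disjoint_elements x y" "x \<le> v" "y \<le> v"
  shows "x + y \<le> v"
proof -
  \<comment> \<open>Chosen so that \<open>?u\<close> exceeds \<open>x - y\<close> and
    \<open>y - x\<close> by twice \<open>v - x\<close> and twice \<open>v - y\<close>, while
    \<open>x + y \<le> ?u\<close> is just twice the claim.\<close>
  let ?u = "2 *\<^sub>R v - x - y"
  have "2 *\<^sub>R x \<le> 2 *\<^sub>R v" "2 *\<^sub>R y \<le> 2 *\<^sub>R v"
    using assms by (auto intro: scaleR_left_mono)
  then have "x - y \<le> ?u" "y - x \<le> ?u"
    by (simp_all add: algebra_simps scaleR_2)
  then have "?u \<in> upper_bounds {x - y, y - x}"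
    by (simp add: upper_bounds_def)
  then have "?u \<in> upper_bounds {x + y, - x - y}"
    using assms(1) unfolding disjoint_elements_def by blast
  then have "x + y \<le> ?u"
    unfolding upper_bounds_def by blast
  then have "2 *\<^sub>R (x + y) \<le> 2 *\<^sub>R v"
    by (simp add: algebra_simps scaleR_2)
  then show ?thesis
    by (simp add: scaleR_le_cancel_left_pos)
qed

text \<open>The admissible coefficients form a closed set containing 0. Were it unbounded, dividing
  by coefficients tending to infinity would give positive vectors converging to \<open>- z\<close>,
  and closedness of the cone would yield \<open>z \<le> 0\<close>.\<close>

lemma maximal_multiple:
  fixes x z :: "'a::{real_normed_vector, ordered_real_vector}"
  assumes closed: "closed {x :: 'a. 0 \<le> x}" and x: "0 \<le> x" and z: "0 < z"
  obtains c where "0 \<le> c" "c *\<^sub>R z \<le> x" "\<And>d. d *\<^sub>R z \<le> x \<Longrightarrow> d \<le> c"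
proof -
  define S where "S = {c. c *\<^sub>R z \<le> x}"
  have "S = (\<lambda>c. x - c *\<^sub>R z) -` {x. 0 \<le> x}"
    by (auto simp: S_def)
  moreover have "closed ((\<lambda>c. x - c *\<^sub>R z) -` {x. 0 \<le> x})"
    by (rule continuous_closed_vimage[OF closed]) (intro continuous_intros)
  ultimately have "closed S" by simp
  have "0 \<in> S" using x by (simp add: S_def)
  have "bdd_above S"
  proof (rule ccontr)
    assume "\<not> bdd_above S"
    then have "\<exists>c\<in>S. real n < c" for n
      by (auto simp: bdd_above_def not_le)
    then obtain c where c: "c n \<in> S" "real n < c n" for n
      by metis
    have pos: "0 < c n" for n
      using c(2)[of n] by (meson le_less_trans of_nat_0_le_iff)
    have "0 \<le> inverse (c n) *\<^sub>R x - z" for n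
    proof -
      have "inverse (c n) *\<^sub>R (c n *\<^sub>R z) \<le> inverse (c n) *\<^sub>R x"
        using c(1)[of n] pos[of n] by (intro scaleR_left_mono) (auto simp: S_def)
      then show ?thesis using pos[of n] by simp
    qed
    moreover have "filterlim c at_top sequentially"
      by (rule filterlim_at_top_mono[OF filterlim_real_sequentially])
        (auto intro!: eventuallyI less_imp_le c(2))
    then have "(\<lambda>n. inverse (c n)) \<longlonglongrightarrow> 0"
      by (rule tendsto_inverse_0_at_top)
    then have "(\<lambda>n. inverse (c n) *\<^sub>R x - z) \<longlonglongrightarrow> 0 *\<^sub>R x - z"
      by (intro tendsto_intros)
    ultimately have "0 \<le> 0 *\<^sub>R x - z"
      using closed_sequentially[OF closed, of "\<lambda>n. inverse (c n) *\<^sub>R x - z"] by blast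
    then show False using z by simp
  qed
  show thesis
  proof
    show "0 \<le> Sup S"
      using \<open>0 \<in> S\<close> \<open>bdd_above S\<close> by (rule cSup_upper)
    have "Sup S \<in> S"
      using \<open>0 \<in> S\<close> \<open>bdd_above S\<close> \<open>closed S\<close> by (intro closed_contains_Sup) auto
    then show "Sup S *\<^sub>R z \<le> x" by (simp add: S_def)
    show "d \<le> Sup S" if "d *\<^sub>R z \<le> x" for d
      using that \<open>bdd_above S\<close> by (intro cSup_upper) (simp_all add: S_def)
  qed
qed

section \<open>Faces and the existence of extremal vectors\<close>

text \<open>For positive \<open>y\<close> this is the linear span of the face of the cone generated
  by \<open>y\<close>, that is, the union of the intervals from \<open>- (t *\<^sub>R y)\<close> to
  \<open>t *\<^sub>R y\<close>. Using the span makes dimension available as a measure.\<close>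

definition face :: "'a::ordered_real_vector \<Rightarrow> 'a set" where
  "face y = {v. \<exists>t. - (t *\<^sub>R y) \<le> v \<and> v \<le> t *\<^sub>R y}"

lemma subspace_face:
  fixes y :: "'a::ordered_real_vector"
  shows "subspace (face y)"
proof (rule subspaceI)
  show "0 \<in> face y"
    by (auto simp: face_def intro!: exI[of _ 0])
next
  fix u v assume "u \<in> face y" "v \<in> face y"
  then obtain s t where "- (s *\<^sub>R y) \<le> u" "u \<le> s *\<^sub>R y" "- (t *\<^sub>R y) \<le> v" "v \<le> t *\<^sub>R y"
    by (auto simp: face_def)
  then have "- (s *\<^sub>R y) + - (t *\<^sub>R y) \<le> u + v" "u + v \<le> s *\<^sub>R y + t *\<^sub>R y"
    by (blast intro: add_mono)+
  then show "u + v \<in> face y"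
    unfolding face_def by (auto simp: scaleR_add_left intro!: exI[of _ "s + t"])
next
  fix c v assume "v \<in> face y"
  then obtain t where t: "- (t *\<^sub>R y) \<le> v" "v \<le> t *\<^sub>R y"
    by (auto simp: face_def)
  then have t': "- v \<le> t *\<^sub>R y"
    by (simp add: minus_le_iff)
  \<comment> \<open>Bounding both \<open>v\<close> and \<open>- v\<close> settles the two signs of
    \<open>c\<close> at once.\<close>
  have "\<bar>c\<bar> *\<^sub>R v \<le> \<bar>c\<bar> *\<^sub>R t *\<^sub>R y" "\<bar>c\<bar> *\<^sub>R (- v) \<le> \<bar>c\<bar> *\<^sub>R t *\<^sub>R y"
    using t(2) t' by (auto intro: scaleR_left_mono simp del: scaleR_minus_right scaleR_scaleR)
  then have "c *\<^sub>R v \<le> (\<bar>c\<bar> * t) *\<^sub>R y" "- (c *\<^sub>R v) \<le> (\<bar>c\<bar> * t) *\<^sub>R y"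
    by (auto simp: abs_if split: if_splits)
  then show "c *\<^sub>R v \<in> face y"
    unfolding face_def using minus_le_iff by blast
qed

lemma face_mono:
  assumes "0 \<le> z" "z \<le> y"
  shows "face z \<subseteq> face y"
proof
  fix v assume "v \<in> face z"
  then obtain t where t: "- (t *\<^sub>R z) \<le> v" "v \<le> t *\<^sub>R z"
    by (auto simp: face_def)
  have "t *\<^sub>R z \<le> \<bar>t\<bar> *\<^sub>R z"
    using assms by (intro scaleR_right_mono) auto
  also have "\<dots> \<le> \<bar>t\<bar> *\<^sub>R y"
    using assms by (intro scaleR_left_mono) auto
  finally have le: "t *\<^sub>R z \<le> \<bar>t\<bar> *\<^sub>R y" .
  then have "- (\<bar>t\<bar> *\<^sub>R y) \<le> - (t *\<^sub>R z)" by simp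
  with t le have "- (\<bar>t\<bar> *\<^sub>R y) \<le> v" "v \<le> \<bar>t\<bar> *\<^sub>R y"
    by (meson order_trans)+
  then show "v \<in> face y"
    unfolding face_def by blast
qed

text \<open>Take \<open>z\<close> in \<open>[0, y]\<close> that is not a multiple of
  \<open>y\<close>, and subtract its maximal multiple from \<open>y\<close>. The rest
  \<open>z'\<close> is nonzero, and its face misses \<open>z\<close>: a bound
  \<open>z \<le> t *\<^sub>R z'\<close> would allow a further multiple
  \<open>inverse t *\<^sub>R z\<close> to be subtracted.\<close>

lemma face_shrink:
  fixes y :: "'a::{real_normed_vector, ordered_real_vector}"
  assumes closed: "closed {x :: 'a. 0 \<le> x}" and y: "0 < y" "\<not> extremal y"
  obtains z where "0 < z" "z \<le> y" "face z \<subset> face y"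
proof -
  obtain z where z: "0 \<le> z" "z \<le> y" "\<And>t. z \<noteq> t *\<^sub>R y"
    using y by (auto simp: extremal_def)
  from z(3)[of 0] z(1) have "0 < z" by simp
  obtain c where c: "0 \<le> c" "c *\<^sub>R z \<le> y" "\<And>d. d *\<^sub>R z \<le> y \<Longrightarrow> d \<le> c"
    using maximal_multiple[OF closed less_imp_le[OF y(1)] \<open>0 < z\<close>] by metis
  from c(3)[of 1] z(2) have "1 \<le> c" by simp
  define z' where "z' = y - c *\<^sub>R z"
  have "z' \<noteq> 0"
  proof
    assume "z' = 0"
    then have "z = inverse c *\<^sub>R y"
      using \<open>1 \<le> c\<close> by (simp add: z'_def)
    with z(3) show False by blast
  qed
  have z'0: "0 < z'"
    using c(2) \<open>z' \<noteq> 0\<close> by (simp add: z'_def order.order_iff_strict)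
  have "z' \<le> y"
    using c(1) z(1) by (simp add: z'_def scaleR_nonneg_nonneg)
  have "z \<notin> face z'"
  proof
    assume "z \<in> face z'"
    then obtain t where t: "z \<le> t *\<^sub>R z'"
      by (auto simp: face_def)
    have "0 < t"
    proof (rule ccontr)
      assume "\<not> 0 < t"
      then have "t *\<^sub>R z' \<le> 0"
        using z'0 by (intro scaleR_nonpos_nonneg) auto
      with t \<open>0 < z\<close> show False by (meson leD order_trans)
    qed
    then have "inverse t *\<^sub>R z \<le> inverse t *\<^sub>R t *\<^sub>R z'"
      using t by (intro scaleR_left_mono) auto
    then have "(inverse t + c) *\<^sub>R z \<le> y"
      using \<open>0 < t\<close> by (simp add: z'_def algebra_simps)
    from c(3)[OF this] \<open>0 < t\<close> show False by simp
  qed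
  moreover have "z \<in> face y"
    unfolding face_def using z(1,2) y(1)
    by (auto intro!: exI[of _ 1] intro: order_trans[of _ 0])
  ultimately have "face z' \<subset> face y"
    using face_mono[OF less_imp_le[OF z'0] \<open>z' \<le> y\<close>] by blast
  with z'0 \<open>z' \<le> y\<close> show thesis by (rule that)
qed

lemma exists_extremal_below:
  fixes y :: "'a::{real_normed_vector, ordered_real_vector}"
  assumes fd: "finite_dimensional TYPE('a)" and closed: "closed {x :: 'a. 0 \<le> x}"
    and "0 < y"
  obtains e where "extremal e" "e \<le> y"
proof -
  obtain B0 :: "'a set" where B0: "finite B0" "span B0 = UNIV"
    using fd by (auto simp: finite_dimensional_def)
  obtain B where B: "B \<subseteq> B0" "independent B" "B0 \<subseteq> span B"
    using maximal_independent_subset by blast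
  have "span B = UNIV"
    using span_mono[OF B(3)] B0(2) by (simp add: span_span top.extremum_unique)
  \<comment> \<open>Finite dimension is a hypothesis here and not part of the type class, so the
    dimension theory is instantiated with the basis \<open>B\<close> extracted from the spanning
    set.\<close>
  interpret fd: finite_dimensional_vector_space "scaleR :: real \<Rightarrow> 'a \<Rightarrow> 'a" B
    by unfold_locales
      (use B B0 \<open>span B = UNIV\<close> in
        \<open>auto simp: dependent_raw_def[symmetric] span_raw_def[symmetric] intro: finite_subset\<close>)
  have "\<exists>e. extremal e \<and> e \<le> y"
    using \<open>0 < y\<close>
  proof (induction "dim (face y)" arbitrary: y rule: less_induct)
    case less
    show ?case
    proof (cases "extremal y")
      case False
      then obtain z where z: "0 < z" "z \<le> y" "face z \<subset> face y"
        using face_shrink[OF closed less.prems] by blast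
      \<comment> \<open>Faces equal their spans, so strict inclusion makes the dimension drop and
        the induction terminates.\<close>
      have "span (face z) \<subset> span (face y)"
        using z(3) by (metis subspace_face span_eq_iff)
      then have "dim (face z) < dim (face y)"
        by (metis fd.dim_psubset dim_raw_def span_raw_def)
      from less.hyps[OF this z(1)] z(2) show ?thesis
        by (meson order_trans)
    qed blast
  qed
  with that show thesis by blast
qed

section \<open>Normalised extremal vectors\<close>

lemma member_le_sum_nonneg:
  fixes f :: "'b \<Rightarrow> 'a::ordered_comm_monoid_add"
  assumes "finite A" "i \<in> A" "\<And>j. j \<in> A \<Longrightarrow> 0 \<le> f j"
  shows "f i \<le> sum f A"
  using sum_mono2[of A "{i}" f] assms by simp

lemma unit_extremals_pos:
  "e \<in> unit_extremals \<Longrightarrow> 0 < e"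
  by (simp add: unit_extremals_def extremal_def)

lemma scaleR_unit_extremals_nonneg:
  "e \<in> unit_extremals \<Longrightarrow> 0 \<le> c \<Longrightarrow> 0 \<le> c *\<^sub>R e"
  by (simp add: scaleR_nonneg_nonneg unit_extremals_pos less_imp_le)

lemma exists_unit_extremal_below:
  fixes y :: "'a::{real_normed_vector, ordered_real_vector}"
  assumes "finite_dimensional TYPE('a)" "closed {x :: 'a. 0 \<le> x}" "0 < y"
  obtains e t where "e \<in> unit_extremals" "0 < t" "t *\<^sub>R e \<le> y"
proof -
  obtain e where e: "extremal e" "e \<le> y"
    using exists_extremal_below[OF assms] .
  then have "e \<noteq> 0" by (auto simp: extremal_def)
  let ?r = "norm e"
  let ?f = "inverse ?r *\<^sub>R e"
  have r: "0 < ?r" using \<open>e \<noteq> 0\<close> by simp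
  have "\<exists>t. z = t *\<^sub>R ?f" if z: "0 \<le> z" "z \<le> ?f" for z
  proof -
    have "?r *\<^sub>R z \<le> ?r *\<^sub>R ?f"
      using z r by (intro scaleR_left_mono) auto
    then have "?r *\<^sub>R z \<le> e" using r by simp
    moreover have "0 \<le> ?r *\<^sub>R z" using z by (simp add: scaleR_nonneg_nonneg)
    ultimately obtain t where "?r *\<^sub>R z = t *\<^sub>R e"
      using e(1) by (auto simp: extremal_def)
    then have "inverse ?r *\<^sub>R ?r *\<^sub>R z = t *\<^sub>R ?f" by (simp add: mult.commute)
    then show ?thesis using r by auto
  qed
  moreover have "0 \<le> ?f" "?f \<noteq> 0"
    using e(1) r \<open>e \<noteq> 0\<close> by (auto simp: extremal_def intro!: scaleR_nonneg_nonneg)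
  then have "0 < ?f" by (simp add: order.strict_iff_order)
  ultimately have "extremal ?f" by (simp add: extremal_def)
  moreover have "norm ?f = 1" using r by simp
  ultimately show thesis
    using r e(2) by (intro that[of ?f ?r]) (simp_all add: unit_extremals_def)
qed

text \<open>For \<open>a > 0\<close>, shifting by \<open>a *\<^sub>R e\<close> and dividing by
  \<open>2 * a\<close> maps the symmetric interval into \<open>[0, e]\<close>, where extremality
  applies.\<close>

lemma extremal_interval:
  fixes e z :: "'a::ordered_real_vector"
  assumes e: "extremal e" and "0 \<le> a" and z: "- (a *\<^sub>R e) \<le> z" "z \<le> a *\<^sub>R e"
  obtains t where "z = t *\<^sub>R e"
proof (cases "a = 0")
  case True
  with z that[of 0] show thesis by simp
next
  case False
  with \<open>0 \<le> a\<close> have a: "0 < a" by simp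
  let ?w = "inverse (2 * a) *\<^sub>R (z + a *\<^sub>R e)"
  have "0 \<le> ?w"
    using add_right_mono[OF z(1), of "a *\<^sub>R e"] a by (intro scaleR_nonneg_nonneg) simp_all
  moreover have "z + a *\<^sub>R e \<le> (a + a) *\<^sub>R e"
    unfolding scaleR_add_left using z(2) by (rule add_right_mono)
  then have "?w \<le> inverse (2 * a) *\<^sub>R ((2 * a) *\<^sub>R e)"
    unfolding mult_2 using a by (intro scaleR_left_mono) auto
  then have "?w \<le> e"
    using a by (simp only: scaleR_scaleR) simp
  ultimately obtain t where "?w = t *\<^sub>R e"
    using e by (auto simp: extremal_def)
  then have "(2 * a) *\<^sub>R ?w = (2 * a * t) *\<^sub>R e" by simp
  then have "z + a *\<^sub>R e = (2 * a * t) *\<^sub>R e" using a by simp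
  then have "z = (2 * a * t - a) *\<^sub>R e" by (simp add: algebra_simps)
  then show thesis by (rule that)
qed

text \<open>A common point is a multiple of both \<open>e\<close> and \<open>f\<close>. Since both
  have norm one, the two coefficients agree up to sign, so a nonzero point would force
  \<open>e = f\<close> or \<open>e = - f\<close>; positivity excludes the latter.\<close>

lemma unit_extremals_interval:
  fixes e f :: "'a::{real_normed_vector, ordered_real_vector}"
  assumes ef: "e \<in> unit_extremals" "f \<in> unit_extremals" "e \<noteq> f" and ab: "0 \<le> a" "0 \<le> b"
  shows "{- (a *\<^sub>R e)..a *\<^sub>R e} \<inter> {- (b *\<^sub>R f)..b *\<^sub>R f} = {0}"
proof -
  have pos: "0 < e" "0 < f" using ef unit_extremals_pos by auto
  have "z = 0" if z: "- (a *\<^sub>R e) \<le> z" "z \<le> a *\<^sub>R e" "- (b *\<^sub>R f) \<le> z" "z \<le> b *\<^sub>R f" for z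
  proof (rule ccontr)
    assume "z \<noteq> 0"
    obtain t where t: "z = t *\<^sub>R e"
      using extremal_interval ef(1) ab(1) z(1,2) unfolding unit_extremals_def by blast
    obtain s where s: "z = s *\<^sub>R f"
      using extremal_interval ef(2) ab(2) z(3,4) unfolding unit_extremals_def by blast
    have "\<bar>t\<bar> = norm z" "\<bar>s\<bar> = norm z"
      using ef by (simp add: t unit_extremals_def, simp add: s unit_extremals_def)
    then have "\<bar>t\<bar> = \<bar>s\<bar>" "t \<noteq> 0" using \<open>z \<noteq> 0\<close> by auto
    then consider "s = t" | "s = - t" by linarith
    then have "e = f \<or> e = - f"
    proof cases
      case 1
      with t s \<open>t \<noteq> 0\<close> show ?thesis by simp
    next
      case 2
      with t s have "t *\<^sub>R e = t *\<^sub>R (- f)" by simp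
      with \<open>t \<noteq> 0\<close> show ?thesis by (metis scaleR_cancel_left)
    qed
    moreover have "e \<noteq> - f"
      using pos by (metis neg_0_less_iff_less less_asym minus_minus)
    ultimately show False using ef(3) by blast
  qed
  moreover have "0 \<le> a *\<^sub>R e" "0 \<le> b *\<^sub>R f"
    using ab pos by (simp_all add: scaleR_nonneg_nonneg)
  ultimately show ?thesis by auto
qed

section \<open>Disjointness turns the extremal vectors into a basis\<close>

context
  assumes disj: "\<And>x y :: 'a::{real_normed_vector, ordered_real_vector}.
    0 \<le> x \<Longrightarrow> 0 \<le> y \<Longrightarrow> {- x..x} \<inter> {- y..y} = {0} \<Longrightarrow> disjoint_elements x y"
begin

text \<open>Each remaining multiple is disjoint from \<open>c m *\<^sub>R m\<close>, so their sum
  stays below \<open>v\<close>. Hence \<open>v - c m *\<^sub>R m\<close> bounds the remaining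
  multiples, and the induction hypothesis is applied to this smaller bound; this is why
  \<open>v\<close> is generalised.\<close>

lemma sum_unit_extremals_le:
  fixes v :: 'a
  assumes "finite S" "S \<subseteq> unit_extremals" "\<And>e. e \<in> S \<Longrightarrow> 0 \<le> c e"
    and "0 \<le> v" "\<And>e. e \<in> S \<Longrightarrow> c e *\<^sub>R e \<le> v"
  shows "(\<Sum>e\<in>S. c e *\<^sub>R e) \<le> v"
  using assms
proof (induction S arbitrary: v rule: finite_induct)
  case (insert m S)
  have "c e *\<^sub>R e \<le> v - c m *\<^sub>R m" if "e \<in> S" for e
  proof -
    have "disjoint_elements (c e *\<^sub>R e) (c m *\<^sub>R m)"
    proof (rule disj)
      show "{- (c e *\<^sub>R e)..c e *\<^sub>R e} \<inter> {- (c m *\<^sub>R m)..c m *\<^sub>R m} = {0}"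
        using insert.prems insert.hyps that by (intro unit_extremals_interval) auto
    qed (use insert.prems that in \<open>auto intro!: scaleR_unit_extremals_nonneg\<close>)
    then have "c e *\<^sub>R e + c m *\<^sub>R m \<le> v"
      using insert.prems(4) that by (intro disjoint_upper_bound) auto
    then show ?thesis by (simp add: le_diff_eq)
  qed
  then have "(\<Sum>e\<in>S. c e *\<^sub>R e) \<le> v - c m *\<^sub>R m"
    using insert.prems by (intro insert.IH) auto
  then show ?case
    using insert.hyps by (simp add: le_diff_eq add.commute)
qed simp

text \<open>The positive and negative parts of a vanishing combination have the same sum
  \<open>w\<close>, which dominates every \<open>\<bar>u v\<bar> *\<^sub>R v\<close>. It therefore
  dominates their total, which is \<open>w + w\<close>. So \<open>w \<le> 0\<close>, and all terms
  vanish.\<close>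

lemma independent_unit_extremals: "independent (unit_extremals :: 'a set)"
  unfolding dependent_explicit
proof clarify
  fix T :: "'a set" and u e
  assume T: "finite T" "T \<subseteq> unit_extremals" and zero: "(\<Sum>v\<in>T. u v *\<^sub>R v) = 0"
    and e: "e \<in> T" "u e \<noteq> 0"
  define p n where "p v = max (u v) 0" and "n v = max (- u v) 0" for v
  define w where "w = (\<Sum>v\<in>T. p v *\<^sub>R v)"
  have "u v *\<^sub>R v = p v *\<^sub>R v - n v *\<^sub>R v" for v
    by (simp add: p_def n_def max_def)
  with zero have w': "w = (\<Sum>v\<in>T. n v *\<^sub>R v)"
    by (simp add: w_def sum_subtractf)
  have pos: "0 \<le> v" if "v \<in> T" for v
    using that T(2) unit_extremals_pos by (auto intro: less_imp_le)
  have "p v *\<^sub>R v \<le> w" if "v \<in> T" for v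
    unfolding w_def using that T(1) pos
    by (intro member_le_sum_nonneg[where f = "\<lambda>v. _ v *\<^sub>R v"]) (auto simp: p_def intro!: scaleR_nonneg_nonneg)
  moreover have "n v *\<^sub>R v \<le> w" if "v \<in> T" for v
    unfolding w' using that T(1) pos
    by (intro member_le_sum_nonneg[where f = "\<lambda>v. _ v *\<^sub>R v"]) (auto simp: n_def intro!: scaleR_nonneg_nonneg)
  ultimately have le: "\<bar>u v\<bar> *\<^sub>R v \<le> w" if "v \<in> T" for v
    using that by (cases "0 \<le> u v") (fastforce simp: p_def n_def max_def)+
  have "0 \<le> w"
    unfolding w_def using pos by (intro sum_nonneg scaleR_nonneg_nonneg) (auto simp: p_def)
  have "(\<Sum>v\<in>T. \<bar>u v\<bar> *\<^sub>R v) \<le> w"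
    using T le \<open>0 \<le> w\<close> by (intro sum_unit_extremals_le) auto
  moreover have "\<bar>u v\<bar> *\<^sub>R v = p v *\<^sub>R v + n v *\<^sub>R v" for v
    by (simp add: p_def n_def max_def)
  then have "(\<Sum>v\<in>T. \<bar>u v\<bar> *\<^sub>R v) = w + w"
    by (simp add: sum.distrib) (simp add: w_def[symmetric] w'[symmetric])
  ultimately have "w \<le> 0" by simp
  with le[OF e(1)] have "\<bar>u e\<bar> *\<^sub>R e \<le> 0" by (rule order_trans)
  moreover have "0 \<le> \<bar>u e\<bar> *\<^sub>R e"
    using pos[OF e(1)] by (simp add: scaleR_nonneg_nonneg)
  ultimately have "\<bar>u e\<bar> *\<^sub>R e = 0" by (rule order_antisym)
  with e T(2) unit_extremals_pos show False by fastforce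
qed

text \<open>Finiteness gives meaning to the sums over \<open>unit_extremals\<close> below, as a sum
  over an infinite set is 0 by convention.\<close>

lemma finite_unit_extremals:
  assumes "finite_dimensional TYPE('a)"
  shows "finite (unit_extremals :: 'a set)"
proof -
  obtain B :: "'a set" where "finite B" "span B = UNIV"
    using assms by (auto simp: finite_dimensional_def)
  then show ?thesis
    using independent_span_bound[of B unit_extremals] independent_unit_extremals by simp
qed

text \<open>Each \<open>c e\<close> is the largest coefficient with
  \<open>c e *\<^sub>R e \<le> x\<close>. The sum \<open>s\<close> stays below \<open>x\<close>; a
  nonzero rest would dominate some \<open>t *\<^sub>R e\<close> with \<open>t > 0\<close>, and since
  \<open>s\<close> already contains \<open>c e *\<^sub>R e\<close>, the coefficient
  \<open>t + c e\<close> would contradict maximality.\<close>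

lemma nonneg_combination:
  fixes x :: 'a
  assumes fd: "finite_dimensional TYPE('a)" and closed: "closed {x :: 'a. 0 \<le> x}" and "0 \<le> x"
  obtains c where "\<And>e. e \<in> unit_extremals \<Longrightarrow> 0 \<le> c e" "x = (\<Sum>e\<in>unit_extremals. c e *\<^sub>R e)"
proof -
  let ?E = "unit_extremals :: 'a set"
  note fin = finite_unit_extremals[OF fd]
  have "\<exists>c. \<forall>e\<in>?E. 0 \<le> c e \<and> c e *\<^sub>R e \<le> x \<and> (\<forall>d. d *\<^sub>R e \<le> x \<longrightarrow> d \<le> c e)"
    by (rule bchoice) (meson maximal_multiple[OF closed \<open>0 \<le> x\<close>] unit_extremals_pos)
  then obtain c where c: "\<And>e. e \<in> ?E \<Longrightarrow> 0 \<le> c e" "\<And>e. e \<in> ?E \<Longrightarrow> c e *\<^sub>R e \<le> x"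
    and max: "\<And>e d. e \<in> ?E \<Longrightarrow> d *\<^sub>R e \<le> x \<Longrightarrow> d \<le> c e"
    by blast
  define s where "s = (\<Sum>e\<in>?E. c e *\<^sub>R e)"
  have "s \<le> x"
    unfolding s_def using c fin \<open>0 \<le> x\<close> by (intro sum_unit_extremals_le) auto
  have "s = x"
  proof (rule ccontr)
    assume "s \<noteq> x"
    with \<open>s \<le> x\<close> have "0 < x - s" by simp
    then obtain e t where e: "e \<in> ?E" "0 < t" "t *\<^sub>R e \<le> x - s"
      by (rule exists_unit_extremal_below[OF fd closed])
    have "c e *\<^sub>R e \<le> s"
      unfolding s_def using c(1) fin e(1)
      by (intro member_le_sum_nonneg[where f = "\<lambda>v. _ v *\<^sub>R v"]) (auto intro!: scaleR_unit_extremals_nonneg)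
    with e(3) have "t *\<^sub>R e + c e *\<^sub>R e \<le> (x - s) + s" by (rule add_mono)
    then have "(t + c e) *\<^sub>R e \<le> x" by (simp add: scaleR_add_left)
    from max[OF e(1) this] e(2) show False by simp
  qed
  with c(1) show thesis
    unfolding s_def by (intro that[of c]) auto
qed

text \<open>By independence, the nonnegative coefficients of the positive difference must be
  \<open>d e - c e\<close>, so the order is coordinatewise.\<close>

lemma combination_le_iff:
  assumes fd: "finite_dimensional TYPE('a)" and closed: "closed {x :: 'a. 0 \<le> x}"
  shows "(\<Sum>e\<in>(unit_extremals :: 'a set). c e *\<^sub>R e) \<le> (\<Sum>e\<in>unit_extremals. d e *\<^sub>R e) \<longleftrightarrow>
    (\<forall>e\<in>(unit_extremals :: 'a set). c e \<le> d e)" (is "?x \<le> ?y \<longleftrightarrow> _")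
proof
  assume "?x \<le> ?y"
  then have "0 \<le> ?y - ?x" by simp
  then obtain k where k: "\<forall>e\<in>(unit_extremals :: 'a set). 0 \<le> k e"
    "?y - ?x = (\<Sum>e\<in>unit_extremals. k e *\<^sub>R e)"
    by (rule nonneg_combination[OF fd closed]) blast
  then have "(\<Sum>e\<in>(unit_extremals :: 'a set). (d e - c e - k e) *\<^sub>R e) = 0"
    by (simp add: sum_subtractf scaleR_diff_left)
  then have "d e - c e - k e = 0" if "e \<in> unit_extremals" for e :: 'a
    using that
    by (rule independentD[OF independent_unit_extremals finite_unit_extremals[OF fd] subset_refl])
  with k(1) show "\<forall>e\<in>(unit_extremals :: 'a set). c e \<le> d e" by fastforce
next
  assume "\<forall>e\<in>(unit_extremals :: 'a set). c e \<le> d e"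
  then show "?x \<le> ?y"
    by (intro sum_mono scaleR_right_mono) (auto intro: less_imp_le[OF unit_extremals_pos])
qed

lemma combination:
  fixes x :: 'a
  assumes fd: "finite_dimensional TYPE('a)" and pre_riesz: "is_pre_riesz TYPE('a)"
    and closed: "closed {x :: 'a. 0 \<le> x}"
  obtains c where "x = (\<Sum>e\<in>unit_extremals. c e *\<^sub>R e)"
proof -
  \<comment> \<open>Directedness applied to \<open>x\<close> and 0 writes \<open>x\<close> as a
    difference of the positive vectors \<open>u\<close> and \<open>u - x\<close>.\<close>
  obtain u where u: "x \<le> u" "0 \<le> u"
    using pre_riesz_directed[OF pre_riesz] .
  obtain c where c: "u = (\<Sum>e\<in>unit_extremals. c e *\<^sub>R e)"
    using nonneg_combination[OF fd closed u(2)] by metis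
  from u(1) have "0 \<le> u - x" by simp
  then obtain d where d: "u - x = (\<Sum>e\<in>unit_extremals. d e *\<^sub>R e)"
    using nonneg_combination[OF fd closed] by metis
  have "x = u - (u - x)" by simp
  also have "\<dots> = (\<Sum>e\<in>unit_extremals. (c e - d e) *\<^sub>R e)"
    unfolding d unfolding c by (simp add: sum_subtractf scaleR_diff_left)
  finally show thesis by (rule that)
qed

end

theorem theorem4p19:
  assumes "finite_dimensional TYPE('a::{real_normed_vector, ordered_real_vector})"
    and "is_pre_riesz TYPE('a)"
    and "closed {x :: 'a. 0 \<le> x}"
    and "\<And>x y :: 'a. 0 \<le> x \<Longrightarrow> 0 \<le> y \<Longrightarrow> {- x..x} \<inter> {- y..y} = {0} \<Longrightarrow> disjoint_elements x y"
  shows "is_vector_lattice TYPE('a)"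
  unfolding is_vector_lattice_def
proof (intro allI)
  fix x y :: 'a
  let ?comb = "\<lambda>c. \<Sum>e\<in>(unit_extremals :: 'a set). c e *\<^sub>R e"
  have comb: "\<exists>c. v = ?comb c" for v
    using combination[OF assms(4,1-3)] by metis
  have le: "?comb c \<le> ?comb d \<longleftrightarrow> (\<forall>e\<in>unit_extremals. c e \<le> d e)" for c d
    by (rule combination_le_iff[OF assms(4,1,3)])
  obtain c d where cd: "x = ?comb c" "y = ?comb d"
    using comb by meson
  \<comment> \<open>By \<open>comb\<close> and \<open>le\<close>, the space is a coordinate space
    with its coordinatewise order, where suprema and infima are coordinatewise maxima and
    minima.\<close>
  have "is_supremum {x, y} (?comb (\<lambda>e. max (c e) (d e)))"
    unfolding is_supremum_def upper_bounds_def
  proof (intro conjI ballI)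
    fix u assume "u \<in> {u. \<forall>a\<in>{x, y}. a \<le> u}"
    moreover obtain k where "u = ?comb k" using comb by meson
    ultimately show "?comb (\<lambda>e. max (c e) (d e)) \<le> u" by (simp add: cd le)
  qed (simp add: cd le)
  moreover have "is_infimum {x, y} (?comb (\<lambda>e. min (c e) (d e)))"
    unfolding is_infimum_def
  proof (intro conjI allI impI)
    fix l assume "\<forall>a\<in>{x, y}. l \<le> a"
    moreover obtain k where "l = ?comb k" using comb by meson
    ultimately show "l \<le> ?comb (\<lambda>e. min (c e) (d e))" by (simp add: cd le)
  qed (simp add: cd le)
  ultimately show "(\<exists>s. is_supremum {x, y} s) \<and> (\<exists>i. is_infimum {x, y} i)"
    by blast
qed

end
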